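(* Let $k$ and $m$ be integers such that $2\le k\le m\le 2k-2$. If $S=(X\times Y,V,\mathcal{A}^{X\times Y})$ is a $(k,m)$-agreeable toroidal society, then $$a(S)\ge\frac{|S|-m+k+2}{4}.$$
   Context: A society is a triple $(X,V,\mathcal{A})$ consisting of a set $X$ (the spectrum, whose elements are called platforms), a finite set $V$ of voters, and a collection $\mathcal{A}=\{A_v\}_{v\in V}$ indexed by the voters, where $A_v\subseteq X$ is the approval set of voter $v$ (different voters may have equal approval sets). The size $|S|$ of a society $S$ is its number of voters. The agreement number $a(S)$ is the greatest number of voters that approve a single platform, i.e. $a(S)=\max_{p\in X}|\{v\in V: p\in A_v\}|$. For integers $1\le k\le m\le|S|$, the society is $(k,m)$-agreeable if among every $m$ voters there are $k$ voters whose approval sets have a common platform; being $(k,m)$-agreeable includes $m\le |S|$. A circular society has as spectrum a circle, and its approval sets are connected subsets of the circle. Given societies $(X,V,\{A^X_v\})$ and $(Y,V,\{A^Y_v\})$ with the same voters $V$, their product society is $(X\times Y,V,\mathcal{A}^{X\times Y})$, where $\mathcal{A}^{X\times Y}=\{A^X_v\times A^Y_v\mid v\in V\}$. A toroidal society is a product of two circular societies. *)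

theory Defs
  imports "HOL-Analysis.Analysis"
begin

text \<open>
  A society consists of a spectrum, a set of voters and a family of approval sets indexed by the
  voters. The values of \<open>approval\<close> outside the set of voters carry no information.
\<close>

record ('p, 'v) society =
  spectrum :: "'p set"
  voters :: "'v set"
  approval :: "'v \<Rightarrow> 'p set"

definition is_society :: "('p, 'v) society \<Rightarrow> bool" where
  "is_society S \<longleftrightarrow> finite (voters S) \<and> (\<forall>v\<in>voters S. approval S v \<subseteq> spectrum S)"

definition society_size :: "('p, 'v) society \<Rightarrow> nat" where
  "society_size S = card (voters S)"

text \<open>
  For a society with nonempty spectrum the maximum below is over a finite nonempty set, even when
  the spectrum is infinite, since all the values are at most the number of voters.
\<close>

definition agreement_number :: "('p, 'v) society \<Rightarrow> nat" where
  "agreement_number S = Max ((\<lambda>p. card {v \<in> voters S. p \<in> approval S v}) ` spectrum S)"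

definition agreeable :: "nat \<Rightarrow> nat \<Rightarrow> ('p, 'v) society \<Rightarrow> bool" where
  "agreeable k m S \<longleftrightarrow>
     1 \<le> k \<and> k \<le> m \<and> m \<le> society_size S \<and>
     (\<forall>W\<subseteq>voters S. card W = m \<longrightarrow>
        (\<exists>K\<subseteq>W. card K = k \<and> (\<exists>p\<in>spectrum S. \<forall>v\<in>K. p \<in> approval S v)))"

text \<open>
  Circles are taken in the Euclidean plane, with arbitrary centre and positive radius. The empty
  set is connected, so a voter may have an empty approval set.
\<close>

definition circular_society :: "(complex, 'v) society \<Rightarrow> bool" where
  "circular_society S \<longleftrightarrow>
     is_society S \<and>
     (\<exists>c r. r > 0 \<and> spectrum S = sphere c r) \<and>
     (\<forall>v\<in>voters S. connected (approval S v))"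

text \<open>
  The product is a relation rather than a function so that the values of \<open>approval\<close> outside the
  set of voters remain unconstrained.
\<close>

definition is_product_society ::
  "('p \<times> 'q, 'v) society \<Rightarrow> ('p, 'v) society \<Rightarrow> ('q, 'v) society \<Rightarrow> bool" where
  "is_product_society P S T \<longleftrightarrow>
     voters S = voters T \<and> voters P = voters S \<and>
     spectrum P = spectrum S \<times> spectrum T \<and>
     (\<forall>v\<in>voters P. approval P v = approval S v \<times> approval T v)"

definition toroidal_society :: "(complex \<times> complex, 'v) society \<Rightarrow> bool" where
  "toroidal_society P \<longleftrightarrow>
     (\<exists>S T. circular_society S \<and> circular_society T \<and> is_product_society P S T)"

end

theory Submission
  imports Defs
begin

text \<open>
  Join two voters by an edge when their approval sets meet. Voters with a common platform are
  pairwise joined, so every \<open>m\<close> voters contain a clique of size \<open>k\<close>. In the range \<open>m \<le> 2 * k - 2\<close>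
  this local condition forces a clique missing at most \<open>m - k\<close> of all the voters
  (\<open>large_clique_if_locally_large_cliques\<close>): in a minimal counterexample every voter is avoided by
  some maximum clique, so the maximum cliques have empty intersection, whereas cliques comprising
  more than half of the vertices cannot, by an inequality going back to Hajnal.

  It remains to find a popular platform for \<open>N = n - m + k\<close> pairwise meeting products of arcs, where
  \<open>n\<close> is the number of voters. On one circle, a family of pairwise meeting arcs is pierced by the
  two endpoints of a smallest arc: any other arc that reaches into it without containing an endpoint
  would be smaller still. Combining the two endpoints on each circle gives four platforms of the
  torus such that each voter approves at least one of them. The voter with the smallest arc in the
  first circle approves both endpoints there, hence at least two of the platforms; the same holds
  for the second circle, and if the two voters coincide, this voter approves all four. The four
  platforms thus receive at least \<open>N + 2\<close> approvals in total, and one of them at least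
  \<open>(N + 2) / 4\<close>.
\<close>

section \<open>Maximum cliques\<close>

text \<open>
  When a clique \<open>C\<close> is added to the family, the intersection loses the vertices outside \<open>C\<close> and the
  union gains the vertices of \<open>C\<close> outside it. The loss is at most the gain, because the old
  intersection together with the part of \<open>C\<close> in the old union is again a clique, and so is no
  larger than \<open>C\<close>.
\<close>

lemma card_Inter_plus_card_Union_maximum_cliques:
  assumes "finite V" and "symp R"
    and max: "\<And>C. C \<subseteq> V \<Longrightarrow> pairwise R C \<Longrightarrow> card C \<le> w"
    and "finite F" and "F \<noteq> {}"
    and F: "\<And>C. C \<in> F \<Longrightarrow> C \<subseteq> V \<and> pairwise R C \<and> card C = w"
  shows "2 * w \<le> card (\<Inter>F) + card (\<Union>F)"
  using \<open>finite F\<close> \<open>F \<noteq> {}\<close> F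
proof (induction F rule: finite_ne_induct)
  case (singleton C)
  then show ?case by simp
next
  case (insert C F)
  let ?A = "\<Inter>F" and ?B = "\<Union>F"
  have "?A \<subseteq> ?B" using \<open>F \<noteq> {}\<close> by blast
  moreover have "?B \<subseteq> V" and C: "C \<subseteq> V" "pairwise R C" "card C = w"
    using insert.prems by auto
  ultimately have fin: "finite ?A" "finite ?B" "finite C"
    using \<open>finite V\<close> by (meson finite_subset)+
  have "R x y" if "x \<in> ?A" "y \<in> ?B" "x \<noteq> y" for x y
    using that insert.prems unfolding pairwise_def by blast
  then have "pairwise R (?A \<union> C \<inter> ?B)"
    using C(2) \<open>?A \<subseteq> ?B\<close> \<open>symp R\<close> unfolding pairwise_def symp_def by blast
  moreover have "?A \<union> C \<inter> ?B \<subseteq> V" using \<open>?A \<subseteq> ?B\<close> \<open>?B \<subseteq> V\<close> by blast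
  ultimately have "card (?A \<union> C \<inter> ?B) \<le> card C" using max C(3) by metis
  moreover have "card (?A \<union> C \<inter> ?B) = card (?A - C) + card (C \<inter> ?B)"
    using fin \<open>?A \<subseteq> ?B\<close> by (subst card_Un_disjoint[symmetric]) (auto intro: arg_cong[where f = card])
  moreover have "card C = card (C - ?B) + card (C \<inter> ?B)"
    using fin by (subst card_Un_disjoint[symmetric]) (auto intro: arg_cong[where f = card])
  moreover have "card ?A = card (?A - C) + card (C \<inter> ?A)"
    using fin by (subst card_Un_disjoint[symmetric]) (auto intro: arg_cong[where f = card])
  moreover have "card (C \<union> ?B) = card (C - ?B) + card ?B"
    using fin by (subst card_Un_disjoint[symmetric]) (auto intro: arg_cong[where f = card])
  moreover have "2 * w \<le> card ?A + card ?B" using insert.IH insert.prems by blast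
  ultimately show ?case by simp
qed

text \<open>
  Induction over the vertex set. If deleting any single vertex leaves a clique of size
  \<open>w = card V - 1 + k - m\<close> but \<open>V\<close> has no larger one, then these cliques are maximum and have no
  common vertex, so the preceding inequality gives \<open>2 * w \<le> card V\<close>. This is false, since
  \<open>m + 2 \<le> 2 * k\<close> and \<open>m < card V\<close>.
\<close>

lemma large_clique_if_locally_large_cliques:
  assumes "finite V" and "symp R" and "m + 2 \<le> 2 * k" and "m \<le> card V"
    and "\<And>W. W \<subseteq> V \<Longrightarrow> card W = m \<Longrightarrow> \<exists>K\<subseteq>W. pairwise R K \<and> card K = k"
  shows "\<exists>K\<subseteq>V. pairwise R K \<and> card K + m = card V + k"
  using assms(1,4,5)
proof (induction "card V" arbitrary: V rule: less_induct)
  case less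
  show ?case
  proof (cases "card V = m")
    case True
    then show ?thesis using less.prems(3)[of V] by auto
  next
    case False
    have "V \<noteq> {}" using False less.prems(2) by auto
    have "\<exists>K\<subseteq>V - {v}. pairwise R K \<and> card K + m = card (V - {v}) + k" if "v \<in> V" for v
    proof (rule less.hyps)
      show "card (V - {v}) < card V" "finite (V - {v})" "m \<le> card (V - {v})"
        using that less.prems False by (auto simp: card_gt_0_iff)
    qed (use less.prems(3) in blast)
    then have "\<forall>v\<in>V. \<exists>K\<subseteq>V - {v}. pairwise R K \<and> card K + m = card V - 1 + k"
      by (metis card_Diff_singleton)
    then obtain K where K: "\<And>v. v \<in> V \<Longrightarrow>
        K v \<subseteq> V - {v} \<and> pairwise R (K v) \<and> card (K v) + m = card V - 1 + k"
      by metis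
    define w where "w = card V - 1 + k - m"
    show ?thesis
    proof (rule ccontr)
      assume *: "\<not> ?thesis"
      have "card C \<le> w" if C: "C \<subseteq> V" "pairwise R C" for C
      proof (rule ccontr)
        assume "\<not> card C \<le> w"
        then have "Suc w \<le> card C" by simp
        then obtain D where "D \<subseteq> C" "card D = Suc w" by (meson obtain_subset_with_card_n)
        moreover have "Suc w + m = card V + k"
          using False less.prems(2) by (simp add: w_def)
        ultimately show False using * C by (metis order_trans pairwise_subset)
      qed
      then have "2 * w \<le> card (\<Inter>(K ` V)) + card (\<Union>(K ` V))"
        by (rule card_Inter_plus_card_Union_maximum_cliques[OF less.prems(1) \<open>symp R\<close>])
          (use less.prems(1) \<open>V \<noteq> {}\<close> K in \<open>fastforce simp: w_def\<close>)+
      moreover have "\<Inter>(K ` V) = {}" using K \<open>V \<noteq> {}\<close> by blast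
      moreover have "card (\<Union>(K ` V)) \<le> card V"
        using K less.prems(1) by (intro card_mono) blast+
      ultimately show False
        using assms(3) False less.prems(2) by (simp add: w_def)
    qed
  qed
qed

section \<open>Arcs on a circle\<close>

lemma circle_parametrization_from:
  fixes c z :: complex
  assumes "r > 0" and "z \<in> sphere c r"
  obtains x where "s \<le> x" and "x < s + 2 * pi" and "z = c + rcis r x"
proof -
  have "norm ((z - c) / rcis r s) = 1"
    using assms by (auto simp: norm_divide dist_norm norm_minus_commute)
  moreover define x where "x = s + Arg2pi ((z - c) / rcis r s)"
  ultimately have "(z - c) / rcis r s = cis (x - s)"
    using Arg2pi_eq[of "(z - c) / rcis r s"] by (simp add: cis_conv_exp)
  then have "z - c = cis (x - s) * rcis r s"
    using assms(1) by (simp add: divide_eq_eq)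
  also have "\<dots> = rcis r x"
    by (simp add: cis_rcis_eq rcis_mult)
  finally have "z = c + rcis r x" by (simp add: algebra_simps)
  moreover have "s \<le> x" "x < s + 2 * pi"
    unfolding x_def by (simp_all add: Arg2pi_ge_0 Arg2pi_lt_2pi)
  ultimately show thesis using that by blast
qed

text \<open>
  Two points cut the circle into two arcs, and a connected set avoiding both points lies in one of
  them: the closed arcs are compact, cover the circle and meet only in the two points.
\<close>

lemma connected_in_circle_avoiding_two_points:
  fixes c :: complex
  assumes "r > 0" and "connected A" and "A \<subseteq> sphere c r"
    and "s \<le> t" and "t \<le> s + 2 * pi"
    and "c + rcis r s \<notin> A" and "c + rcis r t \<notin> A"
  shows "A \<inter> (\<lambda>x. c + rcis r x) ` {s..t} = {} \<or>
         A \<inter> (\<lambda>x. c + rcis r x) ` {t..s + 2 * pi} = {}"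
proof -
  let ?f = "\<lambda>x. c + rcis r x"
  have cont: "continuous_on X ?f" for X
    unfolding rcis_def by (intro continuous_intros)
  have "A \<subseteq> ?f ` {s..t} \<union> ?f ` {t..s + 2 * pi}"
  proof
    fix z assume "z \<in> A"
    then obtain x where "s \<le> x" "x < s + 2 * pi" "z = ?f x"
      using circle_parametrization_from[OF assms(1)] assms(3) by blast
    then show "z \<in> ?f ` {s..t} \<union> ?f ` {t..s + 2 * pi}"
      by (cases "x \<le> t") auto
  qed
  moreover have "?f ` {s..t} \<inter> ?f ` {t..s + 2 * pi} \<inter> A = {}"
  proof -
    have "?f x \<notin> A" if x: "s \<le> x" "x \<le> t" and y: "t \<le> y" "y \<le> s + 2 * pi" and "?f x = ?f y"
      for x y
    proof -
      have "cis (y - x) = 1"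
        using that(5) assms(1) by (simp add: rcis_def flip: cis_divide)
      then have "cos (y - x) = 1" by (metis cis.sel(1) one_complex.sel(1))
      then obtain n :: int where n: "y - x = of_int n * 2 * pi"
        by (auto simp: cos_one_2pi_int)
      have "0 * (2 * pi) \<le> of_int n * (2 * pi)" "of_int n * (2 * pi) \<le> 1 * (2 * pi)"
        using n x y by linarith+
      then have "(0::real) \<le> of_int n" "of_int n \<le> (1::real)"
        by - (erule mult_right_le_imp_le, simp)+
      then have "n = 0 \<or> n = 1" by linarith
      then have "x = t \<or> x = s" using n x y by auto
      then show ?thesis using assms(6,7) by auto
    qed
    then show ?thesis by auto
  qed
  moreover have "closed (?f ` {u..v})" for u v
    by (intro compact_imp_closed compact_continuous_image cont compact_Icc)
  ultimately have "?f ` {s..t} \<inter> A = {} \<or> ?f ` {t..s + 2 * pi} \<inter> A = {}"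
    by (intro connected_closedD[OF assms(2)])
  then show ?thesis by (simp only: Int_commute)
qed

text \<open>
  The arcs need not be closed, so a smallest arc may have no endpoints of its own. Sizes are therefore
  measured on a finite set \<open>F\<close> that contains a point of each intersection of two arcs: \<open>A i\<close> contains the
  fewest points of \<open>F\<close>, and, unless \<open>A i\<close> is the whole circle, \<open>a\<close> and \<open>b\<close> are the first and the last of them along \<open>A i\<close>. That both
  points lie in the same member of the family is what yields the summand \<open>2\<close> in the bound for
  the torus.
\<close>

lemma pairwise_meeting_arcs_pierced_by_two_points:
  fixes c :: complex and A :: "'i \<Rightarrow> complex set"
  assumes "r > 0" and "finite I" and "I \<noteq> {}"
    and arcs: "\<And>i. i \<in> I \<Longrightarrow> connected (A i) \<and> A i \<subseteq> sphere c r"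
    and meet: "\<And>i j. i \<in> I \<Longrightarrow> j \<in> I \<Longrightarrow> A i \<inter> A j \<noteq> {}"
  shows "\<exists>i\<in>I. \<exists>a\<in>A i. \<exists>b\<in>A i. \<forall>j\<in>I. a \<in> A j \<or> b \<in> A j"
proof -
  let ?f = "\<lambda>x. c + rcis r x"
  define p where "p i j = (SOME x. x \<in> A i \<inter> A j)" for i j
  have p: "p i j \<in> A i \<inter> A j" if "i \<in> I" "j \<in> I" for i j
    using meet[OF that] unfolding p_def by (rule some_in_eq[THEN iffD2])
  define F where "F = (\<lambda>(i, j). p i j) ` (I \<times> I)"
  have "finite F" using \<open>finite I\<close> by (simp add: F_def)
  obtain i where "i \<in> I" and min: "\<And>j. j \<in> I \<Longrightarrow> card (A i \<inter> F) \<le> card (A j \<inter> F)"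
    using \<open>I \<noteq> {}\<close> ex_has_least_nat[of "\<lambda>i. i \<in> I" _ "\<lambda>i. card (A i \<inter> F)"] by blast
  have pF: "p i j \<in> A i \<inter> F" "p i j \<in> A j" if "j \<in> I" for j
    using p[OF \<open>i \<in> I\<close> that] that \<open>i \<in> I\<close> by (auto simp: F_def)
  have no_smaller: False if "j \<in> I" "A j \<inter> F \<subseteq> A i \<inter> F - {a}" "a \<in> A i \<inter> F" for j a
  proof -
    have "card (A j \<inter> F) < card (A i \<inter> F)"
      using that \<open>finite F\<close> by (intro psubset_card_mono) auto
    then show False using min[OF that(1)] by simp
  qed
  show ?thesis
  proof (cases "A i = sphere c r")
    case True
    \<comment> \<open>Here \<open>A i\<close> contains all of \<open>F\<close>, so by minimality every arc does; any point of \<open>F\<close>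
      can serve as both piercing points.\<close>
    have "p i i \<in> A j" if "j \<in> I" for j
      using no_smaller[OF that, of "p i i"] pF[OF \<open>i \<in> I\<close>] arcs[OF that] True by blast
    then show ?thesis using \<open>i \<in> I\<close> by blast
  next
    case False
    then obtain q where q: "q \<in> sphere c r" "q \<notin> A i" using arcs[OF \<open>i \<in> I\<close>] by blast
    then obtain s where s: "?f s \<notin> A i"
      using circle_parametrization_from[OF \<open>r > 0\<close> q(1)] by blast
    have "\<exists>t. s \<le> t \<and> t < s + 2 * pi \<and> ?f t = z" if "z \<in> A i" for z
      using circle_parametrization_from[OF \<open>r > 0\<close>, of z c s] arcs[OF \<open>i \<in> I\<close>] that by blast
    then obtain x where x: "\<And>z. z \<in> A i \<Longrightarrow> s \<le> x z \<and> x z < s + 2 * pi \<and> ?f (x z) = z"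
      by metis
    define T where "T = x ` (A i \<inter> F)"
    have T: "finite T" "T \<noteq> {}"
      using \<open>finite F\<close> pF[OF \<open>i \<in> I\<close>] by (auto simp: T_def)
    define \<alpha> where "\<alpha> = Min T"
    define \<beta> where "\<beta> = Max T"
    have inT: "?f t \<in> A i \<inter> F \<and> s \<le> t \<and> t < s + 2 * pi" if "t \<in> T" for t
      using that x by (auto simp: T_def)
    have "\<alpha> \<in> T" "\<beta> \<in> T" and le: "\<And>t. t \<in> T \<Longrightarrow> \<alpha> \<le> t \<and> t \<le> \<beta>"
      using T by (auto simp: \<alpha>_def \<beta>_def)
    then have ab: "?f \<alpha> \<in> A i \<inter> F" "?f \<beta> \<in> A i \<inter> F" "s \<le> \<alpha>" "\<alpha> \<le> \<beta>" "\<beta> < s + 2 * pi"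
      using inT by blast+
    \<comment> \<open>The arc from \<open>\<alpha>\<close> to \<open>\<beta>\<close> lies in \<open>A i\<close>: a gap in it would, together with the missed
      point at \<open>s\<close>, separate the two ends.\<close>
    have sub: "?f t \<in> A i" if t: "\<alpha> \<le> t" "t \<le> \<beta>" for t
    proof (rule ccontr)
      assume "?f t \<notin> A i"
      then have "A i \<inter> ?f ` {s..t} = {} \<or> A i \<inter> ?f ` {t..s + 2 * pi} = {}"
        using arcs[OF \<open>i \<in> I\<close>] ab t s \<open>r > 0\<close>
        by (intro connected_in_circle_avoiding_two_points) auto
      moreover have "?f \<alpha> \<in> ?f ` {s..t}" "?f \<beta> \<in> ?f ` {t..s + 2 * pi}"
        using ab t by auto
      ultimately show False using ab by blast
    qed
    \<comment> \<open>An arc that avoids both ends lies between them, as \<open>p i j\<close> does, and hence in \<open>A i\<close>; it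
      then contains fewer points of \<open>F\<close> than \<open>A i\<close>.\<close>
    have "?f \<alpha> \<in> A j \<or> ?f \<beta> \<in> A j" if "j \<in> I" for j
    proof (rule ccontr)
      assume *: "\<not> ?thesis"
      then have "A j \<inter> ?f ` {\<alpha>..\<beta>} = {} \<or> A j \<inter> ?f ` {\<beta>..\<alpha> + 2 * pi} = {}"
        using arcs[OF \<open>j \<in> I\<close>] ab \<open>r > 0\<close>
        by (intro connected_in_circle_avoiding_two_points) auto
      moreover have "x (p i j) \<in> T" "?f (x (p i j)) = p i j"
        using pF(1)[OF \<open>j \<in> I\<close>] x by (auto simp: T_def)
      then have "p i j \<in> ?f ` {\<alpha>..\<beta>}"
        using le by (metis atLeastAtMost_iff imageI)
      ultimately have disj: "A j \<inter> ?f ` {\<beta>..\<alpha> + 2 * pi} = {}"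
        using pF(2)[OF \<open>j \<in> I\<close>] by blast
      have "A j \<subseteq> A i"
      proof
        fix z assume "z \<in> A j"
        then obtain y where y: "\<alpha> \<le> y" "y < \<alpha> + 2 * pi" "z = ?f y"
          using circle_parametrization_from[OF \<open>r > 0\<close>] arcs[OF \<open>j \<in> I\<close>] by blast
        then have "y \<le> \<beta>" using disj \<open>z \<in> A j\<close> by (cases "y \<le> \<beta>") auto
        then show "z \<in> A i" using sub y by simp
      qed
      then show False using no_smaller[OF \<open>j \<in> I\<close> _ ab(1)] * by blast
    qed
    then show ?thesis using \<open>i \<in> I\<close> ab by blast
  qed
qed

section \<open>Agreement on the torus\<close>

lemma card_le_agreement_number:
  assumes "finite (voters S)" and "p \<in> spectrum S"
    and "K \<subseteq> voters S" and "\<And>v. v \<in> K \<Longrightarrow> p \<in> approval S v"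
  shows "card K \<le> agreement_number S"
proof -
  have "(\<lambda>p. card {v \<in> voters S. p \<in> approval S v}) ` spectrum S \<subseteq> {..card (voters S)}"
    using assms(1) by (auto intro: card_mono)
  then have "card {v \<in> voters S. p \<in> approval S v} \<le> agreement_number S"
    unfolding agreement_number_def using assms(2) by (intro Max_ge) (auto intro: finite_subset)
  moreover have "card K \<le> card {v \<in> voters S. p \<in> approval S v}"
    using assms by (intro card_mono) auto
  ultimately show ?thesis by simp
qed

text \<open>
  The four platforms formed by a piercing pair on each circle receive at least \<open>card K + 2\<close>
  approvals in total, where coinciding platforms are counted repeatedly. A voter's approvals number the product of its approvals on the two circles;
  both factors are positive, the first is \<open>2\<close> for the voter \<open>v\<close> whose arc contains the piercing pair of
  the first circle, and the second is \<open>2\<close> for the corresponding voter \<open>w\<close> of the second circle.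
\<close>

lemma toroidal_agreement_number_of_pairwise_agreeing_voters:
  assumes S: "circular_society S" and T: "circular_society T"
    and P: "is_product_society P S T"
    and K: "K \<subseteq> voters P" "K \<noteq> {}"
    and meet: "\<And>u v. u \<in> K \<Longrightarrow> v \<in> K \<Longrightarrow> approval P u \<inter> approval P v \<noteq> {}"
  shows "card K + 2 \<le> 4 * agreement_number P"
proof -
  have fin: "finite (voters P)" and "finite K"
    using S P K by (auto simp: circular_society_def is_society_def is_product_society_def
        intro: finite_subset)
  have app: "approval P v = approval S v \<times> approval T v" "v \<in> voters S" "v \<in> voters T"
    if "v \<in> K" for v
    using that K P by (auto simp: is_product_society_def)
  have meetST: "approval S u \<inter> approval S v \<noteq> {}" "approval T u \<inter> approval T v \<noteq> {}"
    if "u \<in> K" "v \<in> K" for u v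
    using meet[OF that] app[OF that(1)] app[OF that(2)] by auto
  have pierce: "\<exists>i\<in>K. \<exists>a\<in>approval C i. \<exists>b\<in>approval C i. \<forall>j\<in>K. a \<in> approval C j \<or> b \<in> approval C j"
    if C: "circular_society C" "K \<subseteq> voters C"
      "\<And>u v. u \<in> K \<Longrightarrow> v \<in> K \<Longrightarrow> approval C u \<inter> approval C v \<noteq> {}" for C
  proof -
    obtain c r where "r > 0" "spectrum C = sphere c r"
      using C(1) by (auto simp: circular_society_def)
    then show ?thesis
      using C by (intro pairwise_meeting_arcs_pierced_by_two_points[OF _ \<open>finite K\<close> K(2), of r _ c])
        (auto simp: circular_society_def is_society_def)
  qed
  obtain v a a' where v: "v \<in> K" "a \<in> approval S v" "a' \<in> approval S v"
    and a: "\<And>u. u \<in> K \<Longrightarrow> a \<in> approval S u \<or> a' \<in> approval S u"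
    using pierce[OF S _ meetST(1)] app(2) by blast
  obtain w b b' where w: "w \<in> K" "b \<in> approval T w" "b' \<in> approval T w"
    and b: "\<And>u. u \<in> K \<Longrightarrow> b \<in> approval T u \<or> b' \<in> approval T u"
    using pierce[OF T _ meetST(2)] app(3) by blast
  define N where "N x y = card {u \<in> K. x \<in> approval S u \<and> y \<in> approval T u}" for x y
  have N_sum: "N x y = (\<Sum>u\<in>K. of_bool (x \<in> approval S u) * of_bool (y \<in> approval T u))" for x y
    using \<open>finite K\<close> by (simp add: N_def Int_def flip: of_bool_conj)
  have N_le: "N x y \<le> agreement_number P" if "x \<in> approval S v" "y \<in> approval T w" for x y
  proof -
    have "(x, y) \<in> spectrum P"
      using that S T P app(2)[OF v(1)] app(3)[OF w(1)]
      by (auto simp: circular_society_def is_society_def is_product_society_def)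
    then show ?thesis
      unfolding N_def using fin K(1) app(1) by (intro card_le_agreement_number) auto
  qed
  have "card K + 2 = (\<Sum>u\<in>K. 1 + of_bool (u = v) + of_bool (u = w))"
    using v(1) w(1) \<open>finite K\<close> by (simp add: sum_Suc sum.distrib of_bool_def)
  also have "\<dots> \<le> (\<Sum>u\<in>K. (of_bool (a \<in> approval S u) + of_bool (a' \<in> approval S u)) *
      (of_bool (b \<in> approval T u) + of_bool (b' \<in> approval T u)))"
    using a b v w by (intro sum_mono) (auto simp: of_bool_def)
  also have "\<dots> = N a b + N a b' + N a' b + N a' b'"
    by (simp add: N_sum sum.distrib algebra_simps del: sum_of_bool_eq sum_mult_of_bool_eq sum_of_bool_mult_eq)
  also have "\<dots> \<le> 4 * agreement_number P"
    using N_le[OF v(2) w(2)] N_le[OF v(2) w(3)] N_le[OF v(3) w(2)] N_le[OF v(3) w(3)] by simp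
  finally show ?thesis .
qed

theorem theorem15:
  fixes k m :: nat and S :: "(complex \<times> complex, 'v) society"
  assumes "2 \<le> k" and "k \<le> m" and "m \<le> 2 * k - 2"
    and "toroidal_society S"
    and "agreeable k m S"
  shows "real (agreement_number S) \<ge> (real (society_size S) - real m + real k + 2) / 4"
proof -
  obtain X Y where XY: "circular_society X" "circular_society Y" "is_product_society S X Y"
    using assms(4) by (auto simp: toroidal_society_def)
  then have "finite (voters S)"
    by (simp add: circular_society_def is_society_def is_product_society_def)
  define R where "R u v \<longleftrightarrow> approval S u \<inter> approval S v \<noteq> {}" for u v
  have "\<exists>K\<subseteq>voters S. pairwise R K \<and> card K + m = card (voters S) + k"
  proof (rule large_clique_if_locally_large_cliques)
    show "symp R" by (auto simp: R_def symp_def)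
    show "m \<le> card (voters S)" using assms(5) by (simp add: agreeable_def society_size_def)
    show "\<exists>K\<subseteq>W. pairwise R K \<and> card K = k" if W: "W \<subseteq> voters S" "card W = m" for W
    proof -
      obtain K p where K: "K \<subseteq> W" "card K = k" "\<forall>v\<in>K. p \<in> approval S v"
        using assms(5) W unfolding agreeable_def by metis
      then have "pairwise R K" by (auto simp: pairwise_def R_def)
      then show ?thesis using K by blast
    qed
  qed (use assms(1,3) \<open>finite (voters S)\<close> in auto)
  then obtain K where K: "K \<subseteq> voters S" "pairwise R K" "card K + m = society_size S + k"
    by (auto simp: society_size_def)
  then have "2 \<le> card K" using assms(1,5) by (simp add: agreeable_def)
  \<comment> \<open>The clique property concerns distinct voters; that an approval set is nonempty
    follows from meeting that of a second voter.\<close>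
  have "approval S u \<inter> approval S v \<noteq> {}" if "u \<in> K" "v \<in> K" for u v
  proof (cases "u = v")
    case True
    have "K \<noteq> {u}" using \<open>2 \<le> card K\<close> by auto
    then obtain u' where "u' \<in> K" "u' \<noteq> u" using \<open>u \<in> K\<close> by blast
    then show ?thesis using K(2) \<open>u \<in> K\<close> True unfolding pairwise_def R_def by blast
  qed (use K(2) that in \<open>auto simp: pairwise_def R_def\<close>)
  moreover have "K \<noteq> {}" using \<open>2 \<le> card K\<close> by auto
  ultimately have "card K + 2 \<le> 4 * agreement_number S"
    using toroidal_agreement_number_of_pairwise_agreeing_voters[OF XY K(1)] by blast
  then show ?thesis using K(3) by (simp add: field_simps flip: of_nat_add of_nat_mult)
qed

end
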